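(* Let $(X,d)$ be a premetric space. Then the relation $d$ defined on the collection of all Cauchy families on $X$ (by: $d(F,F')\leq q$ iff for every rational $\varepsilon>0$ there exist $S\in F$ and $T\in F'$ with $\operatorname{diam} S\leq\varepsilon$, $\operatorname{diam} T\leq\varepsilon$ and $\operatorname{diam}(S\cup T)\leq q+\varepsilon$) is a pseudo-premetric on the collection of Cauchy families on $X$.
   Context: A premetric on a nonempty set $X$ is a relation $d$ between $X\times X$ and the nonnegative rationals, written $d(x,y)\leq q$ for $((x,y),q)\in d$, such that for all $x,y,z\in X$ and nonnegative rationals $p,q$: (1) $d(x,y)\leq 0$ iff $x=y$; (2) if $d(x,y)\leq q$ then $d(y,x)\leq q$; (3) if $d(x,z)\leq p$ and $d(z,y)\leq q$ then $d(x,y)\leq p+q$; (4) $d(x,y)\leq p$ iff $d(x,y)\leq q$ for all rationals $q>p$. A pseudo-premetric is such a relation satisfying (2), (3), (4) and $d(x,x)\leq 0$ for all $x$ (instead of (1)). For $A\subseteq X$ and a nonnegative rational $q$, write $\operatorname{diam} A\leq q$ if $d(x,y)\leq q$ for all $x,y\in A$. A Cauchy family on $X$ is a set $F\subseteq\mathcal{P}(X)$ such that (i) $S\cap T\neq\emptyset$ for all $S,T\in F$, and (ii) for every rational $\varepsilon>0$ there is $S\in F$ with $\operatorname{diam} S\leq\varepsilon$. *)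

theory Defs
  imports Complex_Main
begin

text \<open>Here \<open>d(x,y) \<le> q\<close> is a single notation: it stands for membership of \<open>((x,y),q)\<close> in the
  relation \<open>d\<close>. No distance function is involved.\<close>

type_synonym 'a dist_rel = "(('a \<times> 'a) \<times> rat) set"

definition premetric :: "'a set \<Rightarrow> 'a dist_rel \<Rightarrow> bool" where
  "premetric X d \<longleftrightarrow>
     X \<noteq> {} \<and>
     d \<subseteq> (X \<times> X) \<times> {q. 0 \<le> q} \<and>
     (\<forall>x\<in>X. \<forall>y\<in>X. ((x, y), 0) \<in> d \<longleftrightarrow> x = y) \<and>
     (\<forall>x\<in>X. \<forall>y\<in>X. \<forall>q\<ge>0. ((x, y), q) \<in> d \<longrightarrow> ((y, x), q) \<in> d) \<and>
     (\<forall>x\<in>X. \<forall>y\<in>X. \<forall>z\<in>X. \<forall>p\<ge>0. \<forall>q\<ge>0.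
        ((x, z), p) \<in> d \<longrightarrow> ((z, y), q) \<in> d \<longrightarrow> ((x, y), p + q) \<in> d) \<and>
     (\<forall>x\<in>X. \<forall>y\<in>X. \<forall>p\<ge>0. ((x, y), p) \<in> d \<longleftrightarrow> (\<forall>q>p. ((x, y), q) \<in> d))"

definition pseudo_premetric :: "'a set \<Rightarrow> 'a dist_rel \<Rightarrow> bool" where
  "pseudo_premetric X d \<longleftrightarrow>
     X \<noteq> {} \<and>
     d \<subseteq> (X \<times> X) \<times> {q. 0 \<le> q} \<and>
     (\<forall>x\<in>X. ((x, x), 0) \<in> d) \<and>
     (\<forall>x\<in>X. \<forall>y\<in>X. \<forall>q\<ge>0. ((x, y), q) \<in> d \<longrightarrow> ((y, x), q) \<in> d) \<and>
     (\<forall>x\<in>X. \<forall>y\<in>X. \<forall>z\<in>X. \<forall>p\<ge>0. \<forall>q\<ge>0.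
        ((x, z), p) \<in> d \<longrightarrow> ((z, y), q) \<in> d \<longrightarrow> ((x, y), p + q) \<in> d) \<and>
     (\<forall>x\<in>X. \<forall>y\<in>X. \<forall>p\<ge>0. ((x, y), p) \<in> d \<longleftrightarrow> (\<forall>q>p. ((x, y), q) \<in> d))"

definition diam_le :: "'a dist_rel \<Rightarrow> 'a set \<Rightarrow> rat \<Rightarrow> bool" where
  "diam_le d A q \<longleftrightarrow> (\<forall>x\<in>A. \<forall>y\<in>A. ((x, y), q) \<in> d)"

definition cauchy_family :: "'a set \<Rightarrow> 'a dist_rel \<Rightarrow> 'a set set \<Rightarrow> bool" where
  "cauchy_family X d F \<longleftrightarrow>
     F \<subseteq> Pow X \<and>
     (\<forall>S\<in>F. \<forall>T\<in>F. S \<inter> T \<noteq> {}) \<and>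
     (\<forall>\<epsilon>>0. \<exists>S\<in>F. diam_le d S \<epsilon>)"

definition cauchy_dist :: "'a set \<Rightarrow> 'a dist_rel \<Rightarrow> 'a set set dist_rel" where
  "cauchy_dist X d =
     {((F, F'), q) | F F' q.
        cauchy_family X d F \<and> cauchy_family X d F' \<and> 0 \<le> q \<and>
        (\<forall>\<epsilon>>0. \<exists>S\<in>F. \<exists>T\<in>F'.
           diam_le d S \<epsilon> \<and> diam_le d T \<epsilon> \<and> diam_le d (S \<union> T) (q + \<epsilon>))}"

end

theory Submission
  imports Defs
begin

text \<open>For the triangle inequality, sets \<open>T\<close> and \<open>T'\<close> of the middle family that witness the two
  given bounds at \<open>\<epsilon>/2\<close> share a point, through which any point of \<open>S\<close> is joined to any point
  of \<open>U\<close>.\<close>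

text \<open>Since \<open>d\<close> is a subset of the product of \<open>X \<times> X\<close> with
  the nonnegative rationals, membership alone supplies the side conditions of the axioms; the lemmas
  on \<open>d\<close> below can thus omit them.\<close>

lemma premetric_carrier:
  assumes "premetric X d" "((x, y), p) \<in> d"
  shows "x \<in> X" "y \<in> X" "0 \<le> p"
  using assms unfolding premetric_def by auto

lemma premetric_refl:
  assumes "premetric X d" "x \<in> X"
  shows "((x, x), 0) \<in> d"
  using assms unfolding premetric_def by blast

lemma premetric_sym:
  assumes "premetric X d" "((x, y), p) \<in> d"
  shows "((y, x), p) \<in> d"
  using assms premetric_carrier[OF assms] unfolding premetric_def by blast

lemma premetric_triangle:
  assumes "premetric X d" "((x, z), p) \<in> d" "((z, y), q) \<in> d"
  shows "((x, y), p + q) \<in> d"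
  using assms premetric_carrier[OF assms(1,2)] premetric_carrier[OF assms(1,3)]
  unfolding premetric_def by blast

text \<open>For \<open>p < q\<close> this is the forward direction of axiom (4); equality is
  trivial.\<close>

lemma premetric_mono:
  assumes "premetric X d" "((x, y), p) \<in> d" "p \<le> q"
  shows "((x, y), q) \<in> d"
proof (cases "p = q")
  case False
  then have "p < q" using assms(3) by simp
  then show ?thesis
    using assms premetric_carrier[OF assms(1,2)] unfolding premetric_def by blast
qed (use assms in simp)

lemma diam_le_mono:
  assumes "premetric X d" "diam_le d A p" "p \<le> q"
  shows "diam_le d A q"
  using assms(2) premetric_mono[OF assms(1) _ assms(3)] unfolding diam_le_def by blast

lemma diam_le_Un_triangle:
  assumes d: "premetric X d"
    and ST: "diam_le d (S \<union> T) p" and TU: "diam_le d (T' \<union> U) q"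
    and z: "z \<in> T" "z \<in> T'"
  shows "diam_le d (S \<union> U) (p + q)"
proof -
  \<comment> \<open>The point \<open>z\<close> lies in both unions, so the pair
    \<open>(z, z)\<close> is related at \<open>p\<close> and at \<open>q\<close>, and both are
    nonnegative.\<close>
  have "0 \<le> p" "0 \<le> q"
    using premetric_carrier(3)[OF d] ST TU z unfolding diam_le_def by blast+
  then have "diam_le d (S \<union> T) (p + q)" "diam_le d (T' \<union> U) (p + q)"
    using diam_le_mono[OF d] ST TU by auto
  moreover have "((x, y), p + q) \<in> d" if "x \<in> S" "y \<in> U" for x y
    using premetric_triangle[OF d, of x z p y q] ST TU z that unfolding diam_le_def by blast
  \<comment> \<open>Pairs inside \<open>S\<close> or inside \<open>U\<close> are covered by the
    enlarged bounds, pairs from \<open>S\<close> to \<open>U\<close> by the path through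
    \<open>z\<close>, and pairs from \<open>U\<close> to \<open>S\<close> by symmetry.\<close>
  ultimately show ?thesis
    using premetric_sym[OF d] unfolding diam_le_def by blast
qed

text \<open>Provides an element of the collection of Cauchy families, which has to be nonempty to
  carry a pseudo-premetric.\<close>

lemma cauchy_family_singleton:
  assumes "premetric X d" "x \<in> X"
  shows "cauchy_family X d {{x}}"
  using assms premetric_mono[OF assms(1) premetric_refl[OF assms]]
  unfolding cauchy_family_def diam_le_def by auto

lemma cauchy_dist_iff:
  "((F, F'), q) \<in> cauchy_dist X d \<longleftrightarrow>
     cauchy_family X d F \<and> cauchy_family X d F' \<and> 0 \<le> q \<and>
     (\<forall>\<epsilon>>0. \<exists>S\<in>F. \<exists>T\<in>F'. diam_le d S \<epsilon> \<and> diam_le d T \<epsilon> \<and> diam_le d (S \<union> T) (q + \<epsilon>))"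
  unfolding cauchy_dist_def by auto

text \<open>One small set of \<open>F\<close> serves as both witnesses, because
  \<open>S \<union> S = S\<close>.\<close>

lemma cauchy_dist_refl:
  assumes "cauchy_family X d F"
  shows "((F, F), 0) \<in> cauchy_dist X d"
proof -
  have "\<exists>S\<in>F. \<exists>T\<in>F. diam_le d S \<epsilon> \<and> diam_le d T \<epsilon> \<and> diam_le d (S \<union> T) (0 + \<epsilon>)"
    if pos: "0 < \<epsilon>" for \<epsilon>
  proof -
    obtain S where "S \<in> F" "diam_le d S \<epsilon>"
      using assms pos unfolding cauchy_family_def by blast
    then have "diam_le d S \<epsilon> \<and> diam_le d S \<epsilon> \<and> diam_le d (S \<union> S) (0 + \<epsilon>)" by simp
    with \<open>S \<in> F\<close> show ?thesis by blast
  qed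
  then show ?thesis using assms unfolding cauchy_dist_iff by auto
qed

lemma cauchy_dist_sym:
  assumes "((F, G), q) \<in> cauchy_dist X d"
  shows "((G, F), q) \<in> cauchy_dist X d"
proof -
  have "\<exists>T\<in>G. \<exists>S\<in>F. diam_le d T \<epsilon> \<and> diam_le d S \<epsilon> \<and> diam_le d (T \<union> S) (q + \<epsilon>)"
    if pos: "0 < \<epsilon>" for \<epsilon>
  proof -
    obtain S T where "S \<in> F" "T \<in> G" "diam_le d S \<epsilon>" "diam_le d T \<epsilon>" "diam_le d (S \<union> T) (q + \<epsilon>)"
      using assms pos unfolding cauchy_dist_iff by blast
    then show ?thesis by (metis Un_commute)
  qed
  then show ?thesis using assms unfolding cauchy_dist_iff by simp
qed

lemma cauchy_dist_triangle:
  assumes d: "premetric X d"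
    and FH: "((F, H), p) \<in> cauchy_dist X d" and HG: "((H, G), q) \<in> cauchy_dist X d"
  shows "((F, G), p + q) \<in> cauchy_dist X d"
proof -
  have "\<exists>S\<in>F. \<exists>U\<in>G. diam_le d S \<epsilon> \<and> diam_le d U \<epsilon> \<and> diam_le d (S \<union> U) (p + q + \<epsilon>)"
    if "0 < \<epsilon>" for \<epsilon>
  proof -
    \<comment> \<open>Each of the two given bounds contributes a slack of
      \<open>\<epsilon> / 2\<close>, so that the sum has slack \<open>\<epsilon>\<close>.\<close>
    have pos: "0 < \<epsilon> / 2" using that by simp
    obtain S T where S: "S \<in> F" "T \<in> H" "diam_le d S (\<epsilon> / 2)" "diam_le d (S \<union> T) (p + \<epsilon> / 2)"
      using FH pos unfolding cauchy_dist_iff by blast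
    obtain T' U where U: "T' \<in> H" "U \<in> G" "diam_le d U (\<epsilon> / 2)" "diam_le d (T' \<union> U) (q + \<epsilon> / 2)"
      using HG pos unfolding cauchy_dist_iff by blast
    \<comment> \<open>Both sets belong to the Cauchy family \<open>H\<close>, whose members meet
      pairwise.\<close>
    have "T \<inter> T' \<noteq> {}"
      using FH S(2) U(1) unfolding cauchy_dist_iff cauchy_family_def by blast
    then obtain z where "z \<in> T" "z \<in> T'" by blast
    then have "diam_le d (S \<union> U) (p + \<epsilon> / 2 + (q + \<epsilon> / 2))"
      using diam_le_Un_triangle[OF d S(4) U(4)] by blast
    moreover have "p + \<epsilon> / 2 + (q + \<epsilon> / 2) = p + q + \<epsilon>" by simp
    moreover have "diam_le d S \<epsilon>" "diam_le d U \<epsilon>"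
      using diam_le_mono[OF d S(3)] diam_le_mono[OF d U(3)] that by simp_all
    ultimately show ?thesis using S(1) U(2) by metis
  qed
  then show ?thesis using FH HG unfolding cauchy_dist_iff by auto
qed

text \<open>The same witnesses work for \<open>q\<close>: only the bound on the union involves
  \<open>p\<close>, and it becomes weaker.\<close>

lemma cauchy_dist_mono:
  assumes "premetric X d" "((F, G), p) \<in> cauchy_dist X d" "p \<le> q"
  shows "((F, G), q) \<in> cauchy_dist X d"
proof -
  have "diam_le d A (q + \<epsilon>)" if "diam_le d A (p + \<epsilon>)" for A \<epsilon>
    using diam_le_mono[OF assms(1) that] assms(3) by simp
  moreover have "0 \<le> q"
    using assms(2,3) unfolding cauchy_dist_iff by simp
  ultimately show ?thesis
    using assms(2) unfolding cauchy_dist_iff by blast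
qed

text \<open>The tolerance \<epsilon> is split: one half pays for passing from \<open>p\<close> to a
  larger value, the other is the tolerance at that value.\<close>

lemma cauchy_dist_right_closed:
  assumes d: "premetric X d" and "0 \<le> p"
    and above: "\<And>q. p < q \<Longrightarrow> ((F, G), q) \<in> cauchy_dist X d"
  shows "((F, G), p) \<in> cauchy_dist X d"
proof -
  have "\<exists>S\<in>F. \<exists>T\<in>G. diam_le d S \<epsilon> \<and> diam_le d T \<epsilon> \<and> diam_le d (S \<union> T) (p + \<epsilon>)"
    if "0 < \<epsilon>" for \<epsilon>
  proof -
    have pos: "0 < \<epsilon> / 2" using that by simp
    have "((F, G), p + \<epsilon> / 2) \<in> cauchy_dist X d" using above pos by simp
    then obtain S T where ST: "S \<in> F" "T \<in> G" "diam_le d S (\<epsilon> / 2)" "diam_le d T (\<epsilon> / 2)"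
        "diam_le d (S \<union> T) (p + \<epsilon> / 2 + \<epsilon> / 2)"
      using pos unfolding cauchy_dist_iff by blast
    have "diam_le d S \<epsilon>" "diam_le d T \<epsilon>" "diam_le d (S \<union> T) (p + \<epsilon>)"
      using ST(3-5)[THEN diam_le_mono[OF d]] that by simp_all
    then show ?thesis using ST(1,2) by blast
  qed
  \<comment> \<open>Any value above \<open>p\<close> would do here, as \<open>cauchy_dist\<close>
    only relates Cauchy families.\<close>
  moreover have "cauchy_family X d F" "cauchy_family X d G"
    using above[of "p + 1"] unfolding cauchy_dist_iff by auto
  ultimately show ?thesis using \<open>0 \<le> p\<close> unfolding cauchy_dist_iff by blast
qed

theorem theorem2p3:
  fixes X :: "'a set" and d :: "'a dist_rel"
  assumes "premetric X d"
  shows "pseudo_premetric {F. cauchy_family X d F} (cauchy_dist X d)"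
  unfolding pseudo_premetric_def
proof (intro conjI ballI allI impI)
  have "X \<noteq> {}" using assms unfolding premetric_def by (rule conjunct1)
  then obtain x where "x \<in> X" by blast
  then show "{F. cauchy_family X d F} \<noteq> {}"
    using cauchy_family_singleton[OF assms] by blast
  show "cauchy_dist X d \<subseteq>
      ({F. cauchy_family X d F} \<times> {F. cauchy_family X d F}) \<times> {q. 0 \<le> q}"
    unfolding cauchy_dist_def by auto
next
  fix F G p
  assume "0 \<le> (p :: rat)"
  then show "((F, G), p) \<in> cauchy_dist X d \<longleftrightarrow> (\<forall>q>p. ((F, G), q) \<in> cauchy_dist X d)"
    using cauchy_dist_mono[OF assms, OF _ less_imp_le, of F G p]
      cauchy_dist_right_closed[OF assms, of p F G] by blast
qed (auto intro: cauchy_dist_refl cauchy_dist_sym cauchy_dist_triangle[OF assms])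

end
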